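(* Let $m \ge 12$ be an integer. Then there exists a hypergraph $H \in \mathcal{B}$ such that the hypergraph $H_{=m}$ (consisting of the edges of $H$ of size exactly $m$) has no $3$-shallow hitting set.
   Context: A hypergraph $H=(V,E)$ belongs to $\mathcal{B}$ if $V\subset\mathbb{R}^2$ is finite and every edge $e\in E$ is induced by a bottomless rectangle, i.e. can be written as $e=\{(x,y)\in V: x_0<x<x_1,\ y<y_0\}$ for some $x_0,x_1,y_0\in\mathbb{R}$. For a hypergraph $H$, $H_{=m}$ is the hypergraph on the same vertex set whose edges are the edges of $H$ of size exactly $m$. For a hypergraph $(V,E)$ and a positive integer $c$, a set $U\subseteq V$ is a $c$-shallow hitting set if $1\le |e\cap U|\le c$ for every edge $e\in E$. *)

theory Defs
  imports Complex_Main
begin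

type_synonym 'a hypergraph = "'a set \<times> 'a set set"

definition bottomless_induced :: "(real \<times> real) set \<Rightarrow> (real \<times> real) set \<Rightarrow> bool" where
  "bottomless_induced V e \<longleftrightarrow>
     (\<exists>x0 x1 y0. e = {(x, y). (x, y) \<in> V \<and> x0 < x \<and> x < x1 \<and> y < y0})"

text \<open>The edge set is an arbitrary set of bottomless-induced subsets of the vertex set, not
  necessarily all of them, and the points need not be in general position.\<close>
definition bottomless_hypergraphs :: "(real \<times> real) hypergraph set" where
  "bottomless_hypergraphs = {(V, E). finite V \<and> (\<forall>e\<in>E. bottomless_induced V e)}"

definition uniform_part :: "'a hypergraph \<Rightarrow> nat \<Rightarrow> 'a hypergraph" where
  "uniform_part H m = (fst H, {e \<in> snd H. card e = m})"

definition shallow_hitting_set :: "nat \<Rightarrow> 'a hypergraph \<Rightarrow> 'a set \<Rightarrow> bool" where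
  "shallow_hitting_set c H U \<longleftrightarrow>
     U \<subseteq> fst H \<and> (\<forall>e\<in>snd H. 1 \<le> card (e \<inter> U) \<and> card (e \<inter> U) \<le> c)"

end

theory Submission
  imports Defs "HOL-Library.Product_Lexorder"
begin

text \<open>Read the points by increasing height as insertions into a line: at every moment, each \<open>m\<close>
  consecutive points form an edge. Start with \<open>m\<close> points; one of them, \<open>R\<^sub>j\<close>, is hit. Directly to
  the left of each of them insert points \<open>P\<^sub>0, P\<^sub>1, \<dots>\<close> from left to right. Let \<open>v\<close> be \<open>m - 3\<close>
  or \<open>m - 2\<close>. At the moment when \<open>P\<^sub>l, \<dots>, P\<^bsub>l+v-1\<^esub>\<close> are the last \<open>v\<close> inserted, insert a long run
  \<open>Q\<^sub>0, Q\<^sub>1, \<dots>\<close> from left to right just before \<open>P\<^sub>l\<close>. If no point of this window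
  is hit, then any three consecutive \<open>Q\<close> contain a hit, so \<open>12 \<le> m\<close> consecutive ones contain
  four. If two are hit, then these two, \<open>R\<^sub>j\<close> and a hit \<open>Q\<close> lie in a common edge, at the moment
  when this \<open>Q\<close> is inserted. So every window of \<open>m - 3\<close> and every window of \<open>m - 2\<close> consecutive
  \<open>P\<close> has exactly one hit, which is impossible.\<close>

section \<open>Realising abstractly ordered points in the plane\<close>

text \<open>A bottomless rectangle whose left, right and top bounds are points of the set. Keys in
  arbitrary linear orders allow lexicographic coordinates.\<close>

definition box :: "'p set \<Rightarrow> ('p \<Rightarrow> 'a::linorder) \<Rightarrow> ('p \<Rightarrow> 'b::linorder) \<Rightarrow> 'p \<Rightarrow> 'p \<Rightarrow> 'p \<Rightarrow> 'p set"
  where "box T kx ky a b c = {p \<in> T. kx a \<le> kx p \<and> kx p \<le> kx b \<and> ky p \<le> ky c}"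

definition rank :: "'p set \<Rightarrow> ('p \<Rightarrow> 'a::linorder) \<Rightarrow> 'p \<Rightarrow> real"
  where "rank T k p = real (card {q \<in> T. k q < k p})"

lemma rank_le_iff:
  assumes "finite T" "p \<in> T" "q \<in> T"
  shows "rank T k p \<le> rank T k q \<longleftrightarrow> k p \<le> k q"
proof
  assume "k p \<le> k q"
  then show "rank T k p \<le> rank T k q"
    unfolding rank_def using assms(1) by (auto intro!: card_mono)
next
  assume le: "rank T k p \<le> rank T k q"
  show "k p \<le> k q"
  proof (rule ccontr)
    assume "\<not> k p \<le> k q"
    then have "{r \<in> T. k r < k q} \<subset> {r \<in> T. k r < k p}"
      using assms(3) by force
    then have "card {r \<in> T. k r < k q} < card {r \<in> T. k r < k p}"
      using assms(1) by (intro psubset_card_mono) auto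
    then show False
      using le by (simp add: rank_def)
  qed
qed

text \<open>Ranks are integers, so moving a bound by 1 turns the closed conditions of
  \<open>box\<close> into the strict ones of \<open>bottomless_induced\<close>.\<close>

lemma rank_less_Suc_iff:
  assumes "finite T" "p \<in> T" "q \<in> T"
  shows "rank T k p < rank T k q + 1 \<longleftrightarrow> k p \<le> k q"
proof -
  have "real i < real n + 1 \<longleftrightarrow> real i \<le> real n" for i n
    using of_nat_less_iff[of i "Suc n", where 'a = real] by (simp add: add.commute less_Suc_eq_le)
  then have "rank T k p < rank T k q + 1 \<longleftrightarrow> rank T k p \<le> rank T k q"
    unfolding rank_def .
  then show ?thesis
    using rank_le_iff[OF assms] by simp
qed

lemma bottomless_induced_box:
  fixes kx :: "'p \<Rightarrow> 'a::linorder" and ky :: "'p \<Rightarrow> 'b::linorder"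
  defines "f \<equiv> \<lambda>T p. (rank T kx p, rank T ky p)"
  assumes "finite T" "a \<in> T" "b \<in> T" "c \<in> T"
  shows "bottomless_induced (f T ` T) (f T ` box T kx ky a b c)"
proof -
  have *: "p \<in> box T kx ky a b c \<longleftrightarrow> rank T kx a - 1 < rank T kx p \<and>
      rank T kx p < rank T kx b + 1 \<and> rank T ky p < rank T ky c + 1" if "p \<in> T" for p
    using rank_less_Suc_iff[OF assms(2,3) that, of kx] rank_less_Suc_iff[OF assms(2) that assms(4), of kx]
      rank_less_Suc_iff[OF assms(2) that assms(5), of ky] that
    by (auto simp: box_def algebra_simps)
  have "box T kx ky a b c \<subseteq> T"
    by (auto simp: box_def)
  then show ?thesis
    unfolding bottomless_induced_def f_def
    by (intro exI[of _ "rank T kx a - 1"] exI[of _ "rank T kx b + 1"] exI[of _ "rank T ky c + 1"])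
      (use * in auto)
qed

text \<open>Ranks embed \<open>T\<close> into the plane, injectively since \<open>kx\<close> is. A
  hitting set there pulls back to \<open>T\<close> with the same intersection sizes.\<close>

lemma bottomless_hypergraph_of_keys:
  fixes kx :: "'p \<Rightarrow> 'a::linorder" and ky :: "'p \<Rightarrow> 'b::linorder"
  assumes fin: "finite T" and inj: "inj_on kx T"
    and no: "\<And>U. \<exists>a\<in>T. \<exists>b\<in>T. \<exists>c\<in>T. card (box T kx ky a b c) = m \<and>
      \<not> (1 \<le> card (box T kx ky a b c \<inter> U) \<and> card (box T kx ky a b c \<inter> U) \<le> n)"
  shows "\<exists>H \<in> bottomless_hypergraphs. \<not> (\<exists>U. shallow_hitting_set n (uniform_part H m) U)"
proof -
  define f where "f = (\<lambda>p. (rank T kx p, rank T ky p))"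
  have f: "inj_on f T"
    unfolding f_def inj_on_def
    using rank_le_iff[OF fin, of _ _ kx] inj by (metis Pair_inject inj_onD order.antisym order.refl)
  define H where "H = (f ` T, {e. bottomless_induced (f ` T) e})"
  have "H \<in> bottomless_hypergraphs"
    using fin by (simp add: H_def bottomless_hypergraphs_def)
  moreover have False if U: "shallow_hitting_set n (uniform_part H m) U" for U
  proof -
    obtain a b c where abc: "a \<in> T" "b \<in> T" "c \<in> T"
      and card: "card (box T kx ky a b c) = m"
      and bad: "\<not> (1 \<le> card (box T kx ky a b c \<inter> f -` U) \<and> card (box T kx ky a b c \<inter> f -` U) \<le> n)"
      using no by meson
    let ?e = "box T kx ky a b c"
    have "bottomless_induced (f ` T) (f ` ?e)"
      using bottomless_induced_box[OF fin abc] by (simp add: f_def)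
    moreover have inj_e: "inj_on f ?e"
      using f by (rule inj_on_subset) (auto simp: box_def)
    ultimately have "1 \<le> card (f ` ?e \<inter> U) \<and> card (f ` ?e \<inter> U) \<le> n"
      using U card by (auto simp: shallow_hitting_set_def uniform_part_def H_def card_image)
    moreover have "f ` ?e \<inter> U = f ` (?e \<inter> f -` U)"
      by auto
    moreover have "card (f ` (?e \<inter> f -` U)) = card (?e \<inter> f -` U)"
      using inj_e by (intro card_image) (auto intro: inj_on_subset)
    ultimately show False
      using bad by simp
  qed
  ultimately show ?thesis
    by blast
qed

section \<open>The point set\<close>

text \<open>\<open>Q d j l i\<close> is the \<open>i\<close>-th point of the run placed before \<open>P j l\<close> when the window
  \<open>P j l, \<dots>, P j (l + w + d - 1)\<close> is complete, where \<open>d\<close> is 0 or 1.\<close>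

datatype pt = R nat | P nat nat | Q nat nat nat nat

text \<open>The residue mod 3 tells the two runs and \<open>P j l\<close> apart: just before
  \<open>P j l\<close> comes the run with \<open>d = 0\<close>, then that with \<open>d = 1\<close>.
  As \<open>l < 2 * w\<close>, \<open>R j\<close> is the rightmost of its group.\<close>

fun xkey :: "nat \<Rightarrow> pt \<Rightarrow> nat \<times> nat \<times> nat" where
  "xkey w (R j) = (j, 6 * w, 0)"
| "xkey w (P j l) = (j, 3 * l + 2, 0)"
| "xkey w (Q d j l i) = (j, 3 * l + d, i)"

text \<open>The run with \<open>d = 0\<close> before \<open>P j (l + 1)\<close> lies inside the window of the run with \<open>d = 1\<close>
  before \<open>P j l\<close>, so it has to be inserted after the latter, although both windows end with the
  same point.\<close>

fun ykey :: "nat \<Rightarrow> pt \<Rightarrow> nat \<times> nat" where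
  "ykey w (R j) = (0, 0)"
| "ykey w (P j l) = (3 * l + 1, 0)"
| "ykey w (Q d j l i) = (3 * (l + w) + 2 * d, i)"

definition pts :: "nat \<Rightarrow> nat \<Rightarrow> pt set" where
  "pts m w = {R j |j. j < m} \<union> {P j l |j l. j < m \<and> l < 2 * w} \<union>
     {Q d j l i |d j l i. d < 2 \<and> j < m \<and> l + w + d \<le> 2 * w \<and> i \<le> m}"

lemma pts_iff [simp]:
  "R j \<in> pts m w \<longleftrightarrow> j < m"
  "P j l \<in> pts m w \<longleftrightarrow> j < m \<and> l < 2 * w"
  "Q d j l i \<in> pts m w \<longleftrightarrow> d < 2 \<and> j < m \<and> l + w + d \<le> 2 * w \<and> i \<le> m"
  by (auto simp: pts_def)

lemma finite_pts: "finite (pts m w)"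
proof (rule finite_subset)
  let ?B = "R ` {..<m} \<union> (\<Union>j<m. P j ` {..<2 * w}) \<union> (\<Union>d<2. \<Union>j<m. \<Union>l\<le>w. Q d j l ` {..m})"
  show "pts m w \<subseteq> ?B"
    by (auto simp: pts_def image_iff)
  show "finite ?B"
    by simp
qed

lemma inj_on_xkey:
  assumes "0 < w"
  shows "inj_on (xkey w) (pts m w)"
proof (rule inj_onI)
  fix p q assume *: "p \<in> pts m w" "q \<in> pts m w" "xkey w p = xkey w q"
  have QQ: "l = l' \<and> d = d'" if "3 * l + d = 3 * l' + d'" "d < 2" "d' < 2" for l l' d d' :: nat
    using that by presburger
  have PQ: "3 * l + d \<noteq> Suc (Suc (3 * l'))" if "d < 2" for l l' d :: nat
    using that by presburger
  have RQ: "3 * l + d < 6 * w" if "l + d \<le> w" for l d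
    using that assms by linarith
  have RP: "Suc (Suc (3 * l)) < 6 * w" if "l < 2 * w" for l
    using that by linarith
  show "p = q"
  proof (cases p)
    case p: (R j)
    with * show ?thesis
      by (cases q) (auto dest: RQ RP)
  next
    case p: (P j l)
    with * show ?thesis
      by (cases q) (use PQ[symmetric] RP in \<open>force+\<close>)
  next
    case p: (Q d j l i)
    show ?thesis
    proof (cases q)
      case q: (R j')
      show ?thesis
        using * RQ[of l d] unfolding p q by simp
    next
      case q: (P j' l')
      show ?thesis
        using * PQ[of d l l'] unfolding p q by simp
    next
      case q: (Q d' j' l' i')
      show ?thesis
        using * QQ[of l d l' d'] unfolding p q by simp
    qed
  qed
qed

section \<open>The edges used\<close>

abbreviation "pbox m w \<equiv> box (pts m w) (xkey w) (ykey w)"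

lemma pbox_R:
  assumes "0 < m" "0 < w"
  shows "pbox m w (R 0) (R (m - 1)) (R 0) = R ` {..<m}"
proof (rule set_eqI)
  fix p show "p \<in> pbox m w (R 0) (R (m - 1)) (R 0) \<longleftrightarrow> p \<in> R ` {..<m}"
    using assms by (cases p) (auto simp: box_def)
qed

text \<open>Within a group, runs further right are inserted later: both keys order them by
  \<open>(l, d)\<close>. So a box starting in a run and cut at its height meets no other
  run.\<close>

lemma Q_in_pboxD:
  assumes "Q d' j' l' i \<in> pbox m w (Q d j l s) b (Q d j l t)" "d < 2" "fst (xkey w b) = j"
  shows "d' = d \<and> j' = j \<and> l' = l \<and> s \<le> i \<and> i \<le> t"
proof -
  have key: "d' < 2" "j' = j" "3 * l + d \<le> 3 * l' + d'" "3 * l' + 2 * d' \<le> 3 * l + 2 * d"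
    using assms by (auto simp: box_def less_eq_prod_def)
  with assms(2) have "d' = d \<and> l' = l"
    by presburger
  with key assms show ?thesis
    by (auto simp: box_def)
qed

lemma pbox_run:
  assumes "d < 2" "j < m" "l + w + d \<le> 2 * w" "t \<le> m" "0 < w" "0 < s"
  shows "pbox m w (Q d j l s) (Q d j l t) (Q d j l t) = Q d j l ` {s..t}" (is "?B = ?E")
proof (rule set_eqI)
  fix p show "p \<in> ?B \<longleftrightarrow> p \<in> ?E"
  proof (cases p)
    case (Q d' j' l' i)
    show ?thesis
    proof
      assume "p \<in> ?B"
      then have "d' = d \<and> j' = j \<and> l' = l \<and> s \<le> i \<and> i \<le> t"
        unfolding Q by (rule Q_in_pboxD) (use assms(1) in simp_all)
      with Q show "p \<in> ?E"
        by simp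
    next
      assume "p \<in> ?E"
      with Q assms show "p \<in> ?B"
        by (auto simp: box_def)
    qed
  qed (use assms in \<open>auto simp: box_def\<close>)
qed

lemma pbox_run_window:
  assumes "d < 2" "j < m" "l + w + d \<le> 2 * w" "t \<le> m" "0 < w"
  shows "pbox m w (Q d j l s) (P j (l + w + d - 1)) (Q d j l t) =
    Q d j l ` {s..t} \<union> P j ` {l..<l + w + d}" (is "?B = ?E")
proof (rule set_eqI)
  fix p show "p \<in> ?B \<longleftrightarrow> p \<in> ?E"
  proof (cases p)
    case (Q d' j' l' i)
    show ?thesis
    proof
      assume "p \<in> ?B"
      then have "d' = d \<and> j' = j \<and> l' = l \<and> s \<le> i \<and> i \<le> t"
        unfolding Q by (rule Q_in_pboxD) (use assms(1) in simp_all)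
      with Q show "p \<in> ?E"
        by simp
    next
      assume "p \<in> ?E"
      with Q assms show "p \<in> ?B"
        by (auto simp: box_def)
    qed
  qed (use assms in \<open>auto simp: box_def\<close>)
qed

lemma pbox_run_window_R:
  assumes "d < 2" "j < m" "l + w + d \<le> 2 * w" "t \<le> m" "0 < w"
  shows "pbox m w (Q d j l s) (R j) (Q d j l t) =
    insert (R j) (Q d j l ` {s..t} \<union> P j ` {l..<l + w + d})" (is "?B = ?E")
proof (rule set_eqI)
  fix p show "p \<in> ?B \<longleftrightarrow> p \<in> ?E"
  proof (cases p)
    case (Q d' j' l' i)
    show ?thesis
    proof
      assume "p \<in> ?B"
      then have "d' = d \<and> j' = j \<and> l' = l \<and> s \<le> i \<and> i \<le> t"
        unfolding Q by (rule Q_in_pboxD) (use assms(1) in simp_all)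
      with Q show "p \<in> ?E"
        by simp
    next
      assume "p \<in> ?E"
      with Q assms show "p \<in> ?B"
        by (auto simp: box_def)
    qed
  qed (use assms in \<open>auto simp: box_def\<close>)
qed

section \<open>Counting hits\<close>

lemma card_run_window:
  "card (Q d j l ` {s..t} \<union> P j ` {a..<b}) = (Suc t - s) + (b - a)"
  by (subst card_Un_disjoint) (auto simp: card_image inj_on_def)

text \<open>The window has \<open>m - 3 + d\<close> points, so \<open>3 - d\<close> points of the
  run complete an edge, or \<open>2 - d\<close> of them together with \<open>R j\<close>.\<close>

lemma unique_hit_in_window:
  assumes w: "m = w + 3" "12 \<le> m"
    and hit: "\<And>a b c. \<lbrakk>a \<in> pts m w; b \<in> pts m w; c \<in> pts m w; card (pbox m w a b c) = m\<rbrakk> \<Longrightarrow>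
      1 \<le> card (pbox m w a b c \<inter> U) \<and> card (pbox m w a b c \<inter> U) \<le> 3"
    and j: "j < m" "R j \<in> U" and l: "d < 2" "l + w + d \<le> 2 * w"
  shows "\<exists>!k. k \<in> {l..<l + w + d} \<and> P j k \<in> U"
proof -
  have run: "1 \<le> card (Q d j l ` {1..m} \<inter> U) \<and> card (Q d j l ` {1..m} \<inter> U) \<le> 3"
    using hit[of "Q d j l 1" "Q d j l m" "Q d j l m"] w j l
    by (simp add: pbox_run card_image inj_on_def)
  have ex: "\<exists>k. k \<in> {l..<l + w + d} \<and> P j k \<in> U"
  proof (rule ccontr)
    assume none: "\<not> ?thesis"
    have "\<exists>i\<in>{t - 2..t}. Q d j l i \<in> U" if t: "2 \<le> t" "t \<le> m" for t
    proof -
      have "card (Q d j l ` {t - 2 + d..t} \<union> P j ` {l..<l + w + d}) = m"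
        using w l t by (simp add: card_run_window)
      then have "1 \<le> card ((Q d j l ` {t - 2 + d..t} \<union> P j ` {l..<l + w + d}) \<inter> U)"
        using hit[of "Q d j l (t - 2 + d)" "P j (l + w + d - 1)" "Q d j l t"]
          pbox_run_window[of d j m l w t "t - 2 + d"] w j l t
        by auto
      then have "(Q d j l ` {t - 2 + d..t} \<union> P j ` {l..<l + w + d}) \<inter> U \<noteq> {}"
        by fastforce
      with none show ?thesis
        by fastforce
    qed
    \<comment> \<open>These four triples are disjoint and lie within indices 1 to
      \<open>m\<close>.\<close>
    from this[of 3] this[of 6] this[of 9] this[of 12] w(2) obtain i1 i2 i3 i4
      where i: "i1 \<in> {1..3}" "i2 \<in> {4..6}" "i3 \<in> {7..9}" "i4 \<in> {10..12}"
      and U: "Q d j l i1 \<in> U" "Q d j l i2 \<in> U" "Q d j l i3 \<in> U" "Q d j l i4 \<in> U"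
      by auto
    have "card (Q d j l ` {i1, i2, i3, i4}) = 4"
      using i by (subst card_image) (auto simp: inj_on_def)
    moreover have "Q d j l ` {i1, i2, i3, i4} \<subseteq> Q d j l ` {1..m} \<inter> U"
      using i U w by auto
    ultimately have "4 \<le> card (Q d j l ` {1..m} \<inter> U)"
      by (metis card_mono finite_Int finite_atLeastAtMost finite_imageI)
    with run show False
      by simp
  qed
  moreover have "k = k'"
    if k: "k \<in> {l..<l + w + d}" "P j k \<in> U" "k' \<in> {l..<l + w + d}" "P j k' \<in> U" for k k'
  proof (rule ccontr)
    assume ne: "k \<noteq> k'"
    have "Q d j l ` {1..m} \<inter> U \<noteq> {}"
      using run by fastforce
    then obtain i where i: "1 \<le> i" "i \<le> m" "Q d j l i \<in> U"
      by auto
    let ?e = "insert (R j) (Q d j l ` {i - 1 + d..i} \<union> P j ` {l..<l + w + d})"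
    have "card ?e = m"
      using i w l by (subst card_insert_disjoint) (auto simp: card_run_window)
    then have "card (?e \<inter> U) \<le> 3"
      using hit[of "Q d j l (i - 1 + d)" "R j" "Q d j l i"] w j l i
      by (simp add: pbox_run_window_R)
    moreover have "card {R j, Q d j l i, P j k, P j k'} = 4"
      using ne by simp
    moreover have "card {R j, Q d j l i, P j k, P j k'} \<le> card (?e \<inter> U)"
      using i k j l by (intro card_mono) auto
    ultimately show False
      by simp
  qed
  ultimately show ?thesis
    by blast
qed

lemma pts_not_shallow_hit:
  assumes w: "m = w + 3" "12 \<le> m"
  shows "\<exists>a\<in>pts m w. \<exists>b\<in>pts m w. \<exists>c\<in>pts m w. card (pbox m w a b c) = m \<and>
    \<not> (1 \<le> card (pbox m w a b c \<inter> U) \<and> card (pbox m w a b c \<inter> U) \<le> 3)"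
proof (rule ccontr)
  assume "\<not> ?thesis"
  then have hit: "1 \<le> card (pbox m w a b c \<inter> U) \<and> card (pbox m w a b c \<inter> U) \<le> 3"
    if "a \<in> pts m w" "b \<in> pts m w" "c \<in> pts m w" "card (pbox m w a b c) = m" for a b c
    using that by blast
  have "1 \<le> card (R ` {..<m} \<inter> U)"
    using hit[of "R 0" "R (m - 1)" "R 0"] pbox_R[of m w] w(2) w(1)[symmetric]
    by (simp add: card_image inj_on_def)
  then have "R ` {..<m} \<inter> U \<noteq> {}"
    by fastforce
  then obtain j where j: "j < m" "R j \<in> U"
    by auto
  have unique: "\<exists>!k. k \<in> {l..<l + w + d} \<and> P j k \<in> U" if "d < 2" "l + w + d \<le> 2 * w" for d l
  proof (rule unique_hit_in_window[OF w _ j that])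
    show "1 \<le> card (pbox m w a b c \<inter> U) \<and> card (pbox m w a b c \<inter> U) \<le> 3"
      if "a \<in> pts m w" "b \<in> pts m w" "c \<in> pts m w" "card (pbox m w a b c) = m" for a b c
      using that by (rule hit)
  qed
  \<comment> \<open>The window of length \<open>w\<close> starting at \<open>l + 1\<close> has its
    own hit, and the window of length \<open>w + 1\<close> starting at \<open>l\<close> would
    contain both.\<close>
  have "P j l \<notin> U" if l: "l < w" for l
  proof
    assume "P j l \<in> U"
    moreover obtain k where k: "k \<in> {Suc l..<Suc l + w}" "P j k \<in> U"
      using unique[of 0 "Suc l"] l by auto
    moreover have "\<exists>!k. k \<in> {l..<l + w + 1} \<and> P j k \<in> U"
      using unique[of 1 l] l by simp
    moreover have "l \<in> {l..<l + w + 1}" "k \<in> {l..<l + w + 1}"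
      using k by auto
    ultimately have "l = k"
      by blast
    with k show False
      by simp
  qed
  then show False
    using unique[of 0 0] by auto
qed

theorem theorem1:
  fixes m :: nat
  assumes "m \<ge> 12"
  shows "\<exists>H \<in> bottomless_hypergraphs. \<not> (\<exists>U. shallow_hitting_set 3 (uniform_part H m) U)"
proof (rule bottomless_hypergraph_of_keys)
  show "finite (pts m (m - 3))" "inj_on (xkey (m - 3)) (pts m (m - 3))"
    using assms by (auto intro!: finite_pts inj_on_xkey)
  show "\<exists>a\<in>pts m (m - 3). \<exists>b\<in>pts m (m - 3). \<exists>c\<in>pts m (m - 3).
      card (pbox m (m - 3) a b c) = m \<and> \<not> (1 \<le> card (pbox m (m - 3) a b c \<inter> U) \<and>
      card (pbox m (m - 3) a b c \<inter> U) \<le> 3)" for U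
    using assms by (intro pts_not_shallow_hit) auto
qed

end
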